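(* Let $m\ge1$, let $(A,B,c)$ be a triplet over $\mathbb{C}$ with associated polynomial $p$, let $k\in\{1,\dots,m\}$ and $\alpha\in\mathbb{C}$. Let $(\hat A,\hat B,\hat c)$ be the triplet obtained from $(A,B,c)$ by setting $$\hat a_{k,1}=a_{k,1}+\alpha,$$ $$\hat a_{i,j}=a_{i,j}-\alpha\,a_{i,k+2}\,b_{k,j},\qquad \hat b_{i,j}=b_{i,j}-\alpha\,b_{i,k+2}\,b_{k,j}\qquad (j=1,\dots,k+1,\ i=k+1,\dots,m),$$ $$\hat c_j=c_j-\alpha\,c_{k+2}\,b_{k,j}\qquad (j=1,\dots,k+1),$$ with all other entries of $\hat A,\hat B,\hat c$ equal to the corresponding entries of $A,B,c$. Then the polynomial $\hat p$ associated with $(\hat A,\hat B,\hat c)$ satisfies $\hat p=p$.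
   Context: Evaluation scheme. A triplet $(A,B,c)$ (for $m$ multiplications) consists of scalars $a_{i,j},b_{i,j}\in\mathbb{C}$ for $1\le i\le m$, $1\le j\le i+1$ (the entries of $m\times(m+1)$ lower Hessenberg matrices $A,B$; entries with $j>i+1$ are zero), and a vector $c=(c_1,\dots,c_{m+2})\in\mathbb{C}^{m+2}$. The associated polynomial is $p=\sum_{j=1}^{m+2}c_jQ_j\in\mathbb{C}[x]$, where $Q_1=1$, $Q_2=x$, and for $i=1,\dots,m$ $$Q_{i+2}=\Big(\sum_{j=1}^{i+1}a_{i,j}Q_j\Big)\Big(\sum_{j=1}^{i+1}b_{i,j}Q_j\Big).$$ *)

theory Defs
  imports "HOL-Computational_Algebra.Polynomial"
begin

text \<open>
  Matrices and vectors are functions on natural-number indices, and all indices are 1-based.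
  A matrix is lower Hessenberg of size \<open>m \<times> (m + 1)\<close> if it vanishes at every index pair outside
  \<open>1 \<le> i \<le> m\<close>, \<open>1 \<le> j \<le> i + 1\<close>. Requiring zeros also outside the index range \<open>1..m\<close>, \<open>1..m + 1\<close>
  makes the functions correspond exactly to the matrices.
\<close>

definition lower_hessenberg :: "nat \<Rightarrow> (nat \<Rightarrow> nat \<Rightarrow> complex) \<Rightarrow> bool" where
  "lower_hessenberg m A \<longleftrightarrow>
     (\<forall>i j. \<not> (1 \<le> i \<and> i \<le> m \<and> 1 \<le> j \<and> j \<le> i + 1) \<longrightarrow> A i j = 0)"

definition is_triplet ::
  "nat \<Rightarrow> (nat \<Rightarrow> nat \<Rightarrow> complex) \<Rightarrow> (nat \<Rightarrow> nat \<Rightarrow> complex) \<Rightarrow> (nat \<Rightarrow> complex) \<Rightarrow> bool" where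
  "is_triplet m A B c \<longleftrightarrow>
     lower_hessenberg m A \<and> lower_hessenberg m B \<and> (\<forall>j. j \<notin> {1..m + 2} \<longrightarrow> c j = 0)"

text \<open>
  The value at index 0 is a dummy. The last equation is the recursion for \<open>i = n + 1\<close>; it is
  restated with the index \<open>i\<close> in \<open>evalQ_rec\<close>.
\<close>

function evalQ ::
  "(nat \<Rightarrow> nat \<Rightarrow> complex) \<Rightarrow> (nat \<Rightarrow> nat \<Rightarrow> complex) \<Rightarrow> nat \<Rightarrow> complex poly" where
  "evalQ A B 0 = 0"
| "evalQ A B (Suc 0) = 1"
| "evalQ A B (Suc (Suc 0)) = [:0, 1:]"
| "evalQ A B (Suc (Suc (Suc n))) =
     (\<Sum>j = 1..n + 2. smult (A (n + 1) j) (evalQ A B j)) *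
     (\<Sum>j = 1..n + 2. smult (B (n + 1) j) (evalQ A B j))"
  by pat_completeness auto
termination
  by (relation "measure (\<lambda>(A, B, n). n)") auto

lemma evalQ_1: "evalQ A B 1 = 1"
  by simp

lemma evalQ_2: "evalQ A B 2 = [:0, 1:]"
  by (simp add: numeral_2_eq_2)

lemma evalQ_rec:
  assumes "1 \<le> i"
  shows "evalQ A B (i + 2) =
    (\<Sum>j = 1..i + 1. smult (A i j) (evalQ A B j)) *
    (\<Sum>j = 1..i + 1. smult (B i j) (evalQ A B j))"
proof -
  obtain n where n: "i = Suc n"
    using assms by (cases i) auto
  show ?thesis
    using evalQ.simps(4)[of A B n] by (simp add: n del: evalQ.simps)
qed

definition assoc_poly ::
  "nat \<Rightarrow> (nat \<Rightarrow> nat \<Rightarrow> complex) \<Rightarrow> (nat \<Rightarrow> nat \<Rightarrow> complex) \<Rightarrow> (nat \<Rightarrow> complex) \<Rightarrow> complex poly" where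
  "assoc_poly m A B c = (\<Sum>j = 1..m + 2. smult (c j) (evalQ A B j))"

definition hat_A ::
  "nat \<Rightarrow> nat \<Rightarrow> complex \<Rightarrow> (nat \<Rightarrow> nat \<Rightarrow> complex) \<Rightarrow> (nat \<Rightarrow> nat \<Rightarrow> complex) \<Rightarrow> nat \<Rightarrow> nat \<Rightarrow> complex"
where
  "hat_A m k \<alpha> A B i j =
     (if i = k \<and> j = 1 then A k 1 + \<alpha>
      else if i \<in> {k + 1..m} \<and> j \<in> {1..k + 1} then A i j - \<alpha> * A i (k + 2) * B k j
      else A i j)"

definition hat_B ::
  "nat \<Rightarrow> nat \<Rightarrow> complex \<Rightarrow> (nat \<Rightarrow> nat \<Rightarrow> complex) \<Rightarrow> nat \<Rightarrow> nat \<Rightarrow> complex" where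
  "hat_B m k \<alpha> B i j =
     (if i \<in> {k + 1..m} \<and> j \<in> {1..k + 1} then B i j - \<alpha> * B i (k + 2) * B k j
      else B i j)"

definition hat_c ::
  "nat \<Rightarrow> complex \<Rightarrow> (nat \<Rightarrow> nat \<Rightarrow> complex) \<Rightarrow> (nat \<Rightarrow> complex) \<Rightarrow> nat \<Rightarrow> complex" where
  "hat_c k \<alpha> B c j = (if j \<in> {1..k + 1} then c j - \<alpha> * c (k + 2) * B k j else c j)"

lemma is_triplet_hat:
  assumes "is_triplet m A B c" and "k \<in> {1..m}"
  shows "is_triplet m (hat_A m k \<alpha> A B) (hat_B m k \<alpha> B) (hat_c k \<alpha> B c)"
  using assms unfolding is_triplet_def lower_hessenberg_def hat_A_def hat_B_def hat_c_def
  by auto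

end

theory Submission
  imports Defs
begin

text \<open>
  Only the polynomial with index \<open>k + 2\<close> changes: it gains \<open>\<alpha>\<close> times the second factor
  \<open>\<Sum>\<^sub>j b\<^sub>k\<^sub>,\<^sub>j Q\<^sub>j\<close> of its defining product. The corrections to the later rows and to \<open>c\<close> cancel
  this gain in every linear combination in which that polynomial occurs.
\<close>

lemma smult_sum_right: "smult a (sum f I) = (\<Sum>i\<in>I. smult a (f i))"
  by (induction I rule: infinite_finite_induct) (auto simp: smult_add_right)

text \<open>Because \<open>w (k + 2)\<close> is left unchanged, the shift of
  \<open>P (k + 2)\<close> adds \<open>\<alpha> * w (k + 2)\<close> times the sum over row
  \<open>k\<close> of \<open>B\<close>, exactly what the changes at \<open>1..k + 1\<close> remove.
  With \<open>P\<close>, \<open>Q\<close> and \<open>w\<close> arbitrary, this serves the later rows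
  of both matrices and the final vector alike.\<close>

lemma sum_hat_c_eq:
  fixes P Q :: "nat \<Rightarrow> complex poly"
  assumes "k + 2 \<le> N"
    and same: "\<And>j. j \<in> {1..N} \<Longrightarrow> j \<noteq> k + 2 \<Longrightarrow> P j = Q j"
    and shift: "P (k + 2) = Q (k + 2) + smult \<alpha> (\<Sum>j = 1..k + 1. smult (B k j) (Q j))"
  shows "(\<Sum>j = 1..N. smult (hat_c k \<alpha> B w j) (P j)) = (\<Sum>j = 1..N. smult (w j) (Q j))"
proof -
  let ?S = "\<Sum>j = 1..k + 1. smult (B k j) (Q j)"
  let ?v = "\<alpha> * w (k + 2)"
  have split: "{1..N} = {1..k + 1} \<union> ({k + 2} \<union> {k + 3..N})"
    using \<open>k + 2 \<le> N\<close> by auto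
  have decomp: "sum f {1..N} = sum f {1..k + 1} + (f (k + 2) + sum f {k + 3..N})"
    for f :: "nat \<Rightarrow> complex poly"
    unfolding split by (subst sum.union_disjoint; force)+
  have "(\<Sum>j = 1..k + 1. smult (hat_c k \<alpha> B w j) (P j)) =
      (\<Sum>j = 1..k + 1. smult (w j) (Q j) - smult ?v (smult (B k j) (Q j)))"
    using \<open>k + 2 \<le> N\<close> by (intro sum.cong refl) (simp add: hat_c_def same smult_diff_left)
  also have "\<dots> = (\<Sum>j = 1..k + 1. smult (w j) (Q j)) - smult ?v ?S"
    by (simp only: sum_subtractf smult_sum_right)
  finally have low: "(\<Sum>j = 1..k + 1. smult (hat_c k \<alpha> B w j) (P j)) =
      (\<Sum>j = 1..k + 1. smult (w j) (Q j)) - smult ?v ?S" .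
  have mid: "smult (hat_c k \<alpha> B w (k + 2)) (P (k + 2)) =
      smult (w (k + 2)) (Q (k + 2)) + smult ?v ?S"
    unfolding shift by (simp add: hat_c_def smult_add_right mult.commute del: sum.cl_ivl_Suc)
  have high: "(\<Sum>j = k + 3..N. smult (hat_c k \<alpha> B w j) (P j)) =
      (\<Sum>j = k + 3..N. smult (w j) (Q j))"
    by (intro sum.cong refl) (simp add: hat_c_def same)
  show ?thesis
    unfolding decomp low mid high by (simp only: algebra_simps)
qed

text \<open>Strong induction on \<open>n\<close>, comparing the row \<open>i = n - 2\<close> with
  \<open>k\<close>. The bound on \<open>n\<close> keeps \<open>i \<le> m\<close>, the range in which
  the rows after \<open>k\<close> are corrected.\<close>

lemma evalQ_hat:
  assumes "1 \<le> k" and "n \<le> m + 2"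
  shows "evalQ (hat_A m k \<alpha> A B) (hat_B m k \<alpha> B) n =
    evalQ A B n +
    (if n = k + 2 then smult \<alpha> (\<Sum>j = 1..k + 1. smult (B k j) (evalQ A B j)) else 0)"
  using \<open>n \<le> m + 2\<close>
proof (induction n rule: less_induct)
  case (less n)
  let ?A' = "hat_A m k \<alpha> A B" and ?B' = "hat_B m k \<alpha> B"
  let ?P = "evalQ ?A' ?B'" and ?Q = "evalQ A B"
  have "n = 0 \<or> n = 1 \<or> n = 2 \<or> (\<exists>i\<ge>1. n = i + 2)"
    by presburger
  then consider "n = 0" | "n = 1" | "n = 2" | i where "n = i + 2" "1 \<le> i"
    by blast
  then show ?case
  proof cases
    case (4 i)
    have IH: "?P j = ?Q j + (if j = k + 2 then
        smult \<alpha> (\<Sum>l = 1..k + 1. smult (B k l) (?Q l)) else 0)" if "j \<le> i + 1" for j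
      using less.IH[of j] less.prems that 4 by simp
    consider "i < k" | "i = k" | "k < i" by linarith
    then show ?thesis
    proof cases
      case 1
      \<comment> \<open>Rows before \<open>k\<close> are unmodified and only use indices
        \<open>j \<le> i + 1 < k + 2\<close>.\<close>
      have "?P (i + 2) = ?Q (i + 2)"
        unfolding evalQ_rec[OF \<open>1 \<le> i\<close>]
        using 1 by (intro arg_cong2[where f = "(*)"] sum.cong refl)
          (auto simp: IH hat_A_def hat_B_def)
      then show ?thesis using 1 4 by simp
    next
      case 2
      let ?S = "\<Sum>j = 1..k + 1. smult (B k j) (?Q j)"
      \<comment> \<open>The increment \<open>\<alpha>\<close> in column 1 multiplies
        \<open>?Q 1 = 1\<close>, so the left factor gains the constant
        \<open>[:\<alpha>:]\<close>.\<close>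
      have "(\<Sum>j = 1..k + 1. smult (?A' k j) (?P j)) =
          (\<Sum>j = 1..k + 1. smult (A k j) (?Q j) + (if j = 1 then [:\<alpha>:] else 0))"
        using 2 by (intro sum.cong refl) (auto simp: IH hat_A_def smult_add_left)
      also have "\<dots> = (\<Sum>j = 1..k + 1. smult (A k j) (?Q j)) + [:\<alpha>:]"
        unfolding sum.distrib by (subst sum.delta) auto
      finally have left: "(\<Sum>j = 1..k + 1. smult (?A' k j) (?P j)) =
          (\<Sum>j = 1..k + 1. smult (A k j) (?Q j)) + [:\<alpha>:]" .
      have right: "(\<Sum>j = 1..k + 1. smult (?B' k j) (?P j)) = ?S"
        using 2 by (intro sum.cong refl) (auto simp: IH hat_B_def)
      have "?P (k + 2) = ?Q (k + 2) + smult \<alpha> ?S"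
        unfolding evalQ_rec[OF \<open>1 \<le> k\<close>] left right distrib_right by simp
      then show ?thesis using 2 4 by simp
    next
      case 3
      \<comment> \<open>For \<open>k < i \<le> m\<close>, a row of either matrix is corrected by the
        same formula as the vector \<open>c\<close>.\<close>
      have rows: "?A' i = hat_c k \<alpha> B (A i)" "?B' i = hat_c k \<alpha> B (B i)"
        using 3 4 less.prems by (auto simp: hat_A_def hat_B_def hat_c_def fun_eq_iff)
      \<comment> \<open>Here \<open>k < i\<close> gives \<open>k + 2 \<le> i + 1\<close>, so the
        shifted polynomial does occur in the sum.\<close>
      have "(\<Sum>j = 1..i + 1. smult (hat_c k \<alpha> B w j) (?P j)) =
          (\<Sum>j = 1..i + 1. smult (w j) (?Q j))" for w
        by (rule sum_hat_c_eq) (use 3 IH in auto)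
      then have "?P (i + 2) = ?Q (i + 2)"
        unfolding evalQ_rec[OF \<open>1 \<le> i\<close>] rows by simp
      then show ?thesis using 3 4 by simp
    qed
  \<comment> \<open>The initial indices 0, 1, 2 lie below \<open>k + 2 \<ge> 3\<close>, so no shift
    occurs there.\<close>
  qed (use \<open>1 \<le> k\<close> in \<open>auto simp: numeral_2_eq_2\<close>)
qed

theorem theorem3p2:
  fixes m k :: nat and \<alpha> :: complex
    and A B :: "nat \<Rightarrow> nat \<Rightarrow> complex" and c :: "nat \<Rightarrow> complex"
  assumes "m \<ge> 1" and "is_triplet m A B c" and "k \<in> {1..m}"
  shows "assoc_poly m (hat_A m k \<alpha> A B) (hat_B m k \<alpha> B) (hat_c k \<alpha> B c) = assoc_poly m A B c"
  unfolding assoc_poly_def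
  by (rule sum_hat_c_eq) (use assms(3) in \<open>auto simp: evalQ_hat\<close>)

end
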